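(* Let $\mathcal C$ be a binary linear block code of length $n$ and dimension $k\ge1$, with weight spectrum $\{A_d\}$ and minimum Hamming weight $d_{\min}$ (the smallest weight of a nonzero codeword), used with BPSK over an AWGN channel with noise variance $\sigma^2>0$ per component. Then the word-error probability under maximum-likelihood decoding satisfies $$\Pr\{E\}\le\min_{0\le d^*\le n}\Big\{\sum_{d_{\min}\le d\le 2d^*}A_d\,Q\Big(\frac{\sqrt d}{\sigma}\Big)+B(p_b,n,d^*+1,n)\Big\}.$$
   Context: Channel and decoder: codewords are mapped by $\phi:\mathbb F_2^n\to\{-1,+1\}^n$, $\phi(\underline v)_t=1-2v_t$. The all-zero codeword $\underline c^{(0)}$ is transmitted (by symmetry the error probability does not depend on the transmitted codeword); the received vector is $\underline y=\phi(\underline c^{(0)})+\underline z$, with $\underline z$ having i.i.d. $\mathcal N(0,\sigma^2)$ components. Maximum-likelihood (ML) decoding outputs the codeword whose image under $\phi$ is nearest to $\underline y$ in Euclidean distance; $E$ is the event that the output differs from $\underline c^{(0)}$. Notation: $A_d$ is the number of codewords of Hamming weight $d$ ($A_d=0$ for $d>n$); $Q(x)=\int_x^{\infty}\frac1{\sqrt{2\pi}}e^{-z^2/2}\,dz$; $p_b=Q(1/\sigma)$; $B(p,N_t,N_\ell,N_u)=\sum_{m=N_\ell}^{N_u}\binom{N_t}{m}p^m(1-p)^{N_t-m}$. Empty sums are $0$. *)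

theory Defs
  imports "HOL-Probability.Probability" "HOL-Library.Z2"
begin

text \<open>
  Words over the binary field are vectors of type \<open>bit ^ 'n\<close>, so the block length is
  \<open>CARD('n)\<close>, and a linear code is a subspace in the sense of \<open>vec.subspace\<close>.
\<close>

definition hamming_weight :: "bit ^ 'n \<Rightarrow> nat" where
  "hamming_weight v = card {t. v $ t \<noteq> 0}"

definition num_codewords :: "(bit ^ 'n) set \<Rightarrow> nat \<Rightarrow> nat" where
  "num_codewords C d = card {c \<in> C. hamming_weight c = d}"

text \<open>Only meaningful for codes with a nonzero codeword, i.e. of positive dimension.\<close>

definition min_distance :: "(bit ^ 'n) set \<Rightarrow> nat" where
  "min_distance C = Min (hamming_weight ` (C - {0}))"

definition bpsk :: "bit ^ 'n \<Rightarrow> real ^ 'n" where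
  "bpsk v = (\<chi> t. 1 - 2 * of_bit (v $ t))"

definition awgn_output :: "bit ^ 'n \<Rightarrow> ('n \<Rightarrow> 'w \<Rightarrow> real) \<Rightarrow> 'w \<Rightarrow> real ^ 'n" where
  "awgn_output c Z \<omega> = bpsk c + (\<chi> t. Z t \<omega>)"

text \<open>Several codewords may be nearest to the received vector; ties are broken arbitrarily.\<close>

definition ml_decoder :: "(bit ^ 'n) set \<Rightarrow> (real ^ 'n \<Rightarrow> bit ^ 'n) \<Rightarrow> bool" where
  "ml_decoder C dec \<longleftrightarrow> (\<forall>y. is_arg_min (\<lambda>c. dist y (bpsk c)) (\<lambda>c. c \<in> C) (dec y))"

definition Q_fun :: "real \<Rightarrow> real" where
  "Q_fun x = (LINT z:{x..}|lborel. 1 / sqrt (2 * pi) * exp (- z\<^sup>2 / 2))"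

definition binom_sum :: "real \<Rightarrow> nat \<Rightarrow> nat \<Rightarrow> nat \<Rightarrow> real" where
  "binom_sum p Nt Nl Nu = (\<Sum>m = Nl..Nu. real (Nt choose m) * p ^ m * (1 - p) ^ (Nt - m))"

end

theory Submission
  imports Defs
begin

text \<open>
  Compare with a suboptimal decoder, which lists the codewords within Hamming distance \<open>d*\<close>
  of the hard decision and picks the nearest one in the list. If at most \<open>d*\<close> hard decisions
  are wrong, then \<open>0\<close> is in the list and every listed codeword has weight at most \<open>2 d*\<close>,
  so a union bound gives the right-hand side as a bound for this decoder. Maximum-likelihood
  decoding is no worse: it is optimal on average over the codewords, and by linearity of the
  code all codewords are equivalent. Ties have probability zero.
\<close>

section \<open>Product densities and binomial tails\<close>

text \<open>Both measures agree on boxes, where Tonelli splits the integral into factors.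
  \<open>sf\<close> ranges over all indices because the product locale does.\<close>

lemma (in product_sigma_finite) PiM_density:
  assumes "finite I"
    and [measurable]: "\<And>i. i \<in> I \<Longrightarrow> f i \<in> borel_measurable (M i)"
    and sf: "\<And>i. sigma_finite_measure (density (M i) (f i))"
  shows "PiM I (\<lambda>i. density (M i) (f i)) = density (PiM I M) (\<lambda>x. \<Prod>i\<in>I. f i (x i))"
proof -
  interpret D: product_sigma_finite "\<lambda>i. density (M i) (f i)"
    by (intro product_sigma_finite.intro sf)
  have "density (PiM I M) (\<lambda>x. \<Prod>i\<in>I. f i (x i)) = PiM I (\<lambda>i. density (M i) (f i))"
  proof (rule D.PiM_eqI[OF \<open>finite I\<close>])
    show "sets (density (PiM I M) (\<lambda>x. \<Prod>i\<in>I. f i (x i))) = sets (PiM I (\<lambda>i. density (M i) (f i)))"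
      by (simp cong: sets_PiM_cong)
  next
    fix A assume "\<And>i. i \<in> I \<Longrightarrow> A i \<in> sets (density (M i) (f i))"
    then have A: "\<And>i. i \<in> I \<Longrightarrow> A i \<in> sets (M i)" by simp
    have "emeasure (density (PiM I M) (\<lambda>x. \<Prod>i\<in>I. f i (x i))) (Pi\<^sub>E I A)
        = (\<integral>\<^sup>+x. (\<Prod>i\<in>I. f i (x i)) * indicator (Pi\<^sub>E I A) x \<partial>PiM I M)"
      using A \<open>finite I\<close> by (subst emeasure_density) (auto intro!: sets_PiM_I_finite)
    also have "\<dots> = (\<integral>\<^sup>+x. (\<Prod>i\<in>I. f i (x i) * indicator (A i) (x i)) \<partial>PiM I M)"
    proof (rule nn_integral_cong)
      fix x assume "x \<in> space (PiM I M)"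
      then have "indicator (Pi\<^sub>E I A) x = (\<Prod>i\<in>I. indicator (A i) (x i) :: ennreal)"
        using \<open>finite I\<close> by (auto simp: indicator_def space_PiM PiE_iff)
      then show "(\<Prod>i\<in>I. f i (x i)) * indicator (Pi\<^sub>E I A) x
          = (\<Prod>i\<in>I. f i (x i) * indicator (A i) (x i))"
        by (simp add: prod.distrib)
    qed
    also have "\<dots> = (\<Prod>i\<in>I. \<integral>\<^sup>+x. f i x * indicator (A i) x \<partial>M i)"
      using A by (intro product_nn_integral_prod[OF \<open>finite I\<close>]) auto
    also have "\<dots> = (\<Prod>i\<in>I. emeasure (density (M i) (f i)) (A i))"
      using A by (intro prod.cong refl) (simp add: emeasure_density)
    finally show "emeasure (density (PiM I M) (\<lambda>x. \<Prod>i\<in>I. f i (x i))) (Pi\<^sub>E I A)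
        = (\<Prod>i\<in>I. emeasure (density (M i) (f i)) (A i))" .
  qed
  then show ?thesis ..
qed

lemma sum_Pow_card_ge:
  fixes g :: "nat \<Rightarrow> real"
  assumes "finite I"
  shows "(\<Sum>T | T \<subseteq> I \<and> K \<le> card T. g (card T))
    = (\<Sum>m = K..card I. real (card I choose m) * g m)"
proof -
  have "(\<Sum>T | T \<subseteq> I \<and> K \<le> card T. g (card T))
      = (\<Sum>m = K..card I. \<Sum>T | T \<in> {T. T \<subseteq> I \<and> K \<le> card T} \<and> card T = m. g (card T))"
    using assms by (intro sum.group[symmetric]) (auto simp: card_mono)
  also have "\<dots> = (\<Sum>m = K..card I. \<Sum>T | T \<subseteq> I \<and> card T = m. g m)"
    by (intro sum.cong) auto
  also have "\<dots> = (\<Sum>m = K..card I. real (card I choose m) * g m)"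
    by (simp add: n_subsets[OF assms])
  finally show ?thesis .
qed

text \<open>Split by the exact set \<open>T\<close> of indices that land in \<open>B\<close>:
  independence gives the probability of each piece, which depends only on
  \<open>card T\<close>.\<close>

lemma (in prob_space) prob_card_ge_binomial:
  assumes indep: "indep_vars (\<lambda>_. N) X I" and I: "finite I" "I \<noteq> {}"
    and B: "B \<in> sets N"
    and p: "\<And>i. i \<in> I \<Longrightarrow> prob (X i -` B \<inter> space M) = p"
  shows "prob {\<omega> \<in> space M. K \<le> card {i \<in> I. X i \<omega> \<in> B}} = binom_sum p (card I) K (card I)"
proof -
  \<comment> \<open>For \<open>T \<subseteq> I\<close>, this is the event that exactly the indices
    in \<open>T\<close> land in \<open>B\<close>.\<close>
  define ev where "ev T = (\<Inter>i\<in>I. X i -` (if i \<in> T then B else space N - B) \<inter> space M)" for T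
  have X: "X i \<in> measurable M N" if "i \<in> I" for i
    using indep that by (auto simp: indep_vars_def)
  have ev_iff: "\<omega> \<in> ev T \<longleftrightarrow> \<omega> \<in> space M \<and> {i \<in> I. X i \<omega> \<in> B} = T"
    if "T \<subseteq> I" for T \<omega>
    using that I measurable_space[OF X] unfolding ev_def by (auto split: if_splits)
  have prob_ev: "prob (ev T) = p ^ card T * (1 - p) ^ (card I - card T)" if T: "T \<subseteq> I" for T
  proof -
    have compl: "prob (X i -` (space N - B) \<inter> space M) = 1 - p" if "i \<in> I" for i
    proof -
      have "X i -` (space N - B) \<inter> space M = space M - (X i -` B \<inter> space M)"
        using measurable_space[OF X[OF that]] by auto
      then show ?thesis
        using prob_compl[OF measurable_sets[OF X[OF that] B]] p[OF that] by simp
    qed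
    have "prob (ev T) = (\<Prod>i\<in>I. prob (X i -` (if i \<in> T then B else space N - B) \<inter> space M))"
      unfolding ev_def using B I by (intro indep_varsD_finite[OF indep]) auto
    also have "\<dots> = (\<Prod>i\<in>I. if i \<in> T then p else 1 - p)"
      by (intro prod.cong) (auto simp: p compl)
    also have "\<dots> = (\<Prod>i\<in>I \<inter> T. p) * (\<Prod>i\<in>I - T. 1 - p)"
      using I by (simp add: prod.If_cases Diff_eq)
    also have "\<dots> = p ^ card T * (1 - p) ^ (card I - card T)"
      using T I by (simp add: Int_absorb1 card_Diff_subset finite_subset)
    finally show ?thesis .
  qed
  have ev_meas: "ev T \<in> sets M" for T
    unfolding ev_def using I B X by (intro sets.finite_INT) (auto intro!: measurable_sets)
  have "{\<omega> \<in> space M. K \<le> card {i \<in> I. X i \<omega> \<in> B}} = (\<Union>T\<in>{T. T \<subseteq> I \<and> K \<le> card T}. ev T)"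
    using ev_iff by fastforce
  moreover have "prob (\<Union>T\<in>{T. T \<subseteq> I \<and> K \<le> card T}. ev T)
      = (\<Sum>T | T \<subseteq> I \<and> K \<le> card T. prob (ev T))"
    using I ev_iff ev_meas
    by (intro finite_measure_finite_Union) (auto simp: disjoint_family_on_def)
  moreover have "\<dots> = (\<Sum>T | T \<subseteq> I \<and> K \<le> card T. p ^ card T * (1 - p) ^ (card I - card T))"
    by (intro sum.cong) (auto simp: prob_ev)
  ultimately show ?thesis
    using sum_Pow_card_ge[OF I(1), of "\<lambda>m. p ^ m * (1 - p) ^ (card I - m)" K]
    by (simp add: binom_sum_def mult.assoc)
qed

section \<open>Gaussian tails\<close>

lemma Q_fun_nonneg: "0 \<le> Q_fun x"
  unfolding Q_fun_def set_lebesgue_integral_def by (intro integral_nonneg_AE) simp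

lemma (in prob_space) prob_normal_le_neg:
  assumes X: "distributed M lborel X (normal_density 0 s)" and "s > 0"
  shows "prob {\<omega> \<in> space M. X \<omega> \<le> - a} = Q_fun (a / s)"
proof -
  \<comment> \<open>Reflection and rescaling make \<open>- X / s\<close> standard normal and turn
    the lower tail at \<open>- a\<close> into the upper tail at \<open>a / s\<close>.\<close>
  have "distributed M lborel (\<lambda>\<omega>. 0 + (- 1 / s) * X \<omega>)
      (normal_density (0 + (- 1 / s) * 0) (\<bar>- 1 / s\<bar> * s))"
    using assms by (intro normal_density_affine) auto
  then have Y: "distributed M lborel (\<lambda>\<omega>. - X \<omega> / s) (normal_density 0 1)"
    using \<open>s > 0\<close> by simp
  have "{\<omega> \<in> space M. X \<omega> \<le> - a} = (\<lambda>\<omega>. - X \<omega> / s) -` {a / s..} \<inter> space M"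
    using \<open>s > 0\<close> by (auto simp: field_simps)
  also have "emeasure M \<dots> = (\<integral>\<^sup>+x. ennreal (normal_density 0 1 x) * indicator {a / s..} x \<partial>lborel)"
    by (intro distributed_emeasure[OF Y]) simp
  also have "\<dots> = (\<integral>\<^sup>+x. ennreal (indicator {a / s..} x *\<^sub>R normal_density 0 1 x) \<partial>lborel)"
    by (intro nn_integral_cong) (simp add: indicator_def)
  also have "\<dots> = ennreal (\<integral>x. indicator {a / s..} x *\<^sub>R normal_density 0 1 x \<partial>lborel)"
    by (intro nn_integral_eq_integral integrable_mult_indicator) auto
  also have "\<dots> = ennreal (Q_fun (a / s))"
    by (simp add: Q_fun_def set_lebesgue_integral_def std_normal_density_def)
  finally show ?thesis
    by (simp add: emeasure_eq_measure Q_fun_nonneg)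
qed

lemma (in prob_space) prob_normal_singleton:
  assumes X: "distributed M lborel X (normal_density \<mu> s)"
  shows "prob {\<omega> \<in> space M. X \<omega> = a} = 0"
proof -
  have "emeasure M (X -` {a} \<inter> space M) = (\<integral>\<^sup>+x. ennreal (normal_density \<mu> s x) * indicator {a} x \<partial>lborel)"
    by (intro distributed_emeasure[OF X]) simp
  also have "\<dots> = 0"
    by (simp add: nn_integral_indicator_singleton)
  finally show ?thesis
    by (simp add: measure_def vimage_def Int_def conj_commute)
qed

section \<open>Words, correlations and hard decisions\<close>

lemma bpsk_nth: "bpsk v $ t = (if v $ t = 0 then 1 else - 1)"
  by (cases "v $ t") (auto simp: bpsk_def)

lemma bpsk_zero [simp]: "bpsk 0 $ t = 1"
  by (simp add: bpsk_nth)

text \<open>Addition over the binary field becomes multiplication of signs; the symmetry arguments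
  about the code rest on this.\<close>

lemma bpsk_add: "bpsk (v + w) $ t = bpsk v $ t * bpsk w $ t"
  by (cases "v $ t"; cases "w $ t") (auto simp: bpsk_nth)

lemma bit_vec_add_self [simp]: "v + v = (0 :: bit ^ 'n)"
  by (simp add: vec_eq_iff)

lemma finite_bit_vec: "finite (S :: (bit ^ 'n) set)"
proof (rule finite_subset[OF subset_UNIV], rule finite_imageD)
  show "finite ((\<lambda>v :: bit ^ 'n. {t. v $ t \<noteq> 0}) ` UNIV)"
    by (rule finite_subset[of _ "Pow UNIV"]) auto
  show "inj (\<lambda>v :: bit ^ 'n. {t. v $ t \<noteq> 0})"
    by (rule injI) (simp add: set_eq_iff vec_eq_iff, metis bit_not_zero_iff)
qed

text \<open>Inner product of \<open>y\<close> with the image of \<open>c\<close>. Received vectors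
  are functions here, so that their laws live on \<open>PiM\<close>.\<close>

definition corr :: "bit ^ 'n \<Rightarrow> ('n \<Rightarrow> real) \<Rightarrow> real" where
  "corr c y = (\<Sum>t\<in>UNIV. bpsk c $ t * y t)"

text \<open>
  Positions with \<open>y t = 0\<close> count as disagreements with every word; this makes
  \<open>card_disagree_le\<close> and \<open>disagree_flip\<close> hold without exceptional points.
\<close>

definition disagree :: "bit ^ 'n \<Rightarrow> ('n \<Rightarrow> real) \<Rightarrow> nat" where
  "disagree c y = card {t. bpsk c $ t * y t \<le> 0}"

text \<open>By symmetry of the noise, this turns a vector received for the word \<open>0\<close>
  into one distributed as if \<open>c\<close> had been sent.\<close>

definition flip :: "bit ^ 'n \<Rightarrow> ('n \<Rightarrow> real) \<Rightarrow> 'n \<Rightarrow> real" where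
  "flip c y = (\<lambda>t. bpsk c $ t * y t)"

lemma corr_flip: "corr c (flip c' y) = corr (c + c') y"
  by (simp add: corr_def flip_def bpsk_add mult.assoc)

lemma disagree_flip: "disagree c (flip c' y) = disagree (c + c') y"
  by (simp add: disagree_def flip_def bpsk_add mult.assoc)

lemma corr_zero_diff: "corr 0 y - corr c y = 2 * (\<Sum>t | c $ t \<noteq> 0. y t)"
proof -
  have "corr 0 y - corr c y = (\<Sum>t\<in>UNIV. if c $ t \<noteq> 0 then 2 * y t else 0)"
    unfolding corr_def sum_subtractf[symmetric] by (intro sum.cong) (auto simp: bpsk_nth)
  also have "\<dots> = (\<Sum>t | c $ t \<noteq> 0. 2 * y t)"
    by (simp add: sum.If_cases)
  finally show ?thesis by (simp add: sum_distrib_left)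
qed

text \<open>On the support of \<open>c\<close> the words \<open>0\<close> and \<open>c\<close> have
  opposite signs, so \<open>y\<close> disagrees with at least one of them there: the triangle
  inequality through the hard decision.\<close>

lemma hamming_weight_le_disagree: "hamming_weight c \<le> disagree 0 y + disagree c y"
proof -
  have "{t. c $ t \<noteq> 0} \<subseteq> {t. bpsk 0 $ t * y t \<le> 0} \<union> {t. bpsk c $ t * y t \<le> 0}"
    by (auto simp: bpsk_nth)
  then have "hamming_weight c \<le> card ({t. bpsk 0 $ t * y t \<le> 0} \<union> {t. bpsk c $ t * y t \<le> 0})"
    unfolding hamming_weight_def by (intro card_mono) auto
  also have "\<dots> \<le> disagree 0 y + disagree c y"
    unfolding disagree_def by (rule card_Un_le)
  finally show ?thesis .
qed

text \<open>All images under \<open>bpsk\<close> have the same norm, so only the correlation term of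
  the squared distance depends on the codeword.\<close>

lemma dist_bpsk_le_iff:
  "dist y (bpsk c) \<le> dist y (bpsk c') \<longleftrightarrow> corr c' (($) y) \<le> corr c (($) y)"
proof -
  have sq: "(dist y (bpsk c))\<^sup>2 = (\<Sum>t\<in>UNIV. (y $ t)\<^sup>2 + 1) - 2 * corr c (($) y)" for c
  proof -
    have "(dist y (bpsk c))\<^sup>2 = (\<Sum>t\<in>UNIV. (y $ t - bpsk c $ t)\<^sup>2)"
      by (simp add: dist_vec_def L2_set_def sum_nonneg dist_real_def)
    also have "\<dots> = (\<Sum>t\<in>UNIV. ((y $ t)\<^sup>2 + 1) - 2 * (bpsk c $ t * y $ t))"
      by (intro sum.cong) (auto simp: bpsk_nth power2_eq_square algebra_simps)
    finally show ?thesis by (simp add: corr_def sum_subtractf sum_distrib_left)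
  qed
  have "dist y (bpsk c) \<le> dist y (bpsk c') \<longleftrightarrow> (dist y (bpsk c))\<^sup>2 \<le> (dist y (bpsk c'))\<^sup>2"
    by (simp add: power_mono_iff)
  then show ?thesis unfolding sq by simp
qed

lemma corr_measurable [measurable]:
  "corr c \<in> borel_measurable (PiM UNIV (\<lambda>_ :: 'n :: finite. borel))"
  unfolding corr_def by measurable

lemma disagree_measurable [measurable]:
  "disagree c \<in> measurable (PiM UNIV (\<lambda>_ :: 'n :: finite. borel)) (count_space UNIV)"
proof -
  have "disagree c = (\<lambda>y. \<Sum>t\<in>UNIV. if bpsk c $ t * y t \<le> 0 then 1 else 0)"
    by (auto simp: disagree_def fun_eq_iff sum.If_cases)
  then show ?thesis by simp
qed

lemma flip_measurable [measurable]:
  "flip c \<in> measurable (PiM UNIV (\<lambda>_. borel)) (PiM UNIV (\<lambda>_ :: 'n :: finite. borel))"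
  unfolding flip_def by (rule measurable_PiM_single') (auto simp: space_PiM)

lemma hamming_weight_pos: "c \<noteq> 0 \<Longrightarrow> hamming_weight (c :: bit ^ 'n) > 0"
  by (auto simp: hamming_weight_def card_gt_0_iff vec_eq_iff)

section \<open>Decision regions of the two decoders\<close>

text \<open>Ties are included: for nonempty \<open>C\<close> the regions of its codewords cover the
  whole space, but they may overlap.\<close>

definition nearest :: "(bit ^ 'n) set \<Rightarrow> bit ^ 'n \<Rightarrow> ('n \<Rightarrow> real) set" where
  "nearest C c = {y. \<forall>c'\<in>C. corr c' y \<le> corr c y}"

text \<open>
  Received vectors for which the suboptimal decoder outputs \<open>0\<close>: list the codewords within
  Hamming distance \<open>ds\<close> of the hard decision, then take the nearest one in the list.
\<close>

definition list_correct :: "(bit ^ 'n) set \<Rightarrow> nat \<Rightarrow> ('n \<Rightarrow> real) set" where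
  "list_correct C ds = {y. disagree 0 y \<le> ds \<and>
    (\<forall>c\<in>C - {0}. disagree c y \<le> ds \<longrightarrow> corr c y < corr 0 y)}"

lemma space_PiM_borel [simp]: "space (PiM UNIV (\<lambda>_ :: 'n :: finite. borel :: real measure)) = UNIV"
  by (simp add: space_PiM)

lemma nearest_measurable [measurable]: "nearest C c \<in> sets (PiM UNIV (\<lambda>_ :: 'n :: finite. borel))"
proof -
  have "{y \<in> space (PiM UNIV (\<lambda>_. borel)). \<forall>c'\<in>C. corr c' y \<le> corr c y}
      \<in> sets (PiM UNIV (\<lambda>_. borel))"
    by (intro sets.sets_Collect_finite_All finite_bit_vec) measurable
  then show ?thesis by (simp add: nearest_def)
qed

lemma list_correct_measurable [measurable]:
  "list_correct C ds \<in> sets (PiM UNIV (\<lambda>_ :: 'n :: finite. borel))"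
proof -
  have "{y \<in> space (PiM UNIV (\<lambda>_. borel)). disagree 0 y \<le> ds \<and>
      (\<forall>c\<in>C - {0}. disagree c y \<le> ds \<longrightarrow> corr c y < corr 0 y)} \<in> sets (PiM UNIV (\<lambda>_. borel))"
    by (intro sets.sets_Collect_conj sets.sets_Collect_finite_All finite_bit_vec) measurable
  then show ?thesis by (simp add: list_correct_def)
qed

text \<open>Translation by \<open>c\<close> permutes the code and moves \<open>0\<close> to
  \<open>c\<close>, and \<open>flip c\<close> translates the correlations accordingly.\<close>

lemma flip_in_nearest:
  assumes C: "vec.subspace C" and "c \<in> C" and y: "flip c y \<in> nearest C c"
  shows "y \<in> nearest C 0"
proof -
  have "corr c' y \<le> corr 0 y" if "c' \<in> C" for c'
  proof -
    have "c' + c \<in> C" using C that \<open>c \<in> C\<close> by (simp add: vec.subspace_add)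
    then have "corr (c' + c) (flip c y) \<le> corr c (flip c y)"
      using y by (simp add: nearest_def)
    then show ?thesis by (simp add: corr_flip add.assoc)
  qed
  then show ?thesis by (simp add: nearest_def)
qed

text \<open>If \<open>flip c y\<close> lies in \<open>list_correct C ds\<close>, then for
  \<open>y\<close> the codeword \<open>c\<close> is listed and strictly beats every other listed
  codeword. Two such codewords would beat each other.\<close>

lemma flip_list_correct_unique:
  assumes C: "vec.subspace C" and c: "c1 \<in> C" "c2 \<in> C"
    and y: "flip c1 y \<in> list_correct C ds" "flip c2 y \<in> list_correct C ds"
  shows "c1 = c2"
proof (rule ccontr)
  assume "c1 \<noteq> c2"
  have less: "corr b y < corr a y"
    if "a \<in> C" "b \<in> C" "a \<noteq> b" "flip a y \<in> list_correct C ds" "flip b y \<in> list_correct C ds" for a b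
  proof -
    have "b + a \<in> C - {0}"
      using C that by (metis Diff_iff add_eq_0_iff bit_vec_add_self minus_unique singletonD vec.subspace_add)
    \<comment> \<open>The word \<open>b\<close> is listed for \<open>y\<close> because
      \<open>flip b y\<close> is in \<open>list_correct C ds\<close>; seen from
      \<open>flip a y\<close> it appears as \<open>b + a\<close>.\<close>
    moreover have "disagree (b + a) (flip a y) \<le> ds"
      using that(5) by (simp add: list_correct_def disagree_flip add.assoc)
    ultimately have "corr (b + a) (flip a y) < corr 0 (flip a y)"
      using that(4) by (simp add: list_correct_def)
    then show ?thesis by (simp add: corr_flip add.assoc)
  qed
  show False
    using less[of c1 c2] less[of c2 c1] c y \<open>c1 \<noteq> c2\<close> by simp
qed

section \<open>Likelihoods on the Gaussian channel\<close>

text \<open>Both means have square 1, so the quadratic terms cancel in the quotient of the densities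
  and the exponent is linear in \<open>x\<close>.\<close>

lemma normal_density_sign_flip:
  assumes "\<bar>e\<bar> = 1"
  shows "normal_density e s x = exp ((e - 1) * x / s\<^sup>2) * normal_density 1 s x"
proof -
  have e: "e = 1 \<or> e = -1" using assms by linarith
  show ?thesis
  proof (cases "s = 0")
    case False
    have "- (x - e)\<^sup>2 / (2 * s\<^sup>2) = (e - 1) * x / s\<^sup>2 + - (x - 1)\<^sup>2 / (2 * s\<^sup>2)"
      using e False by (auto simp: field_simps power2_eq_square)
    then show ?thesis unfolding normal_density_def by (simp only: exp_add mult_ac)
  \<comment> \<open>For \<open>s = 0\<close> both densities are 0, since division by zero yields
    0.\<close>
  qed (simp add: normal_density_def)
qed

locale awgn = prob_space +
  fixes Z :: "'n :: finite \<Rightarrow> 'a \<Rightarrow> real" and \<sigma> :: real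
  assumes sigma_pos: "\<sigma> > 0"
    and indep: "indep_vars (\<lambda>_. borel) Z UNIV"
    and normal: "\<And>t. distributed M lborel (Z t) (normal_density 0 \<sigma>)"
begin

definition received :: "'a \<Rightarrow> 'n \<Rightarrow> real" where
  "received \<omega> = (\<lambda>t. 1 + Z t \<omega>)"

lemma Z_measurable [measurable]: "Z t \<in> borel_measurable M"
  using distributed_measurable[OF normal[of t]] by simp

lemma received_measurable [measurable]:
  "received \<in> measurable M (PiM UNIV (\<lambda>_. borel))"
  unfolding received_def by (rule measurable_PiM_single') auto

text \<open>The likelihood of \<open>y\<close> when \<open>c\<close> is sent.\<close>

definition joint_density :: "bit ^ 'n \<Rightarrow> ('n \<Rightarrow> real) \<Rightarrow> real" where
  "joint_density c y = (\<Prod>t\<in>UNIV. normal_density (bpsk c $ t) \<sigma> (y t))"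

text \<open>The likelihood ratio of \<open>c\<close> to \<open>0\<close> is
  \<open>exp ((corr c y - corr 0 y) / \<sigma>\<^sup>2)\<close>.\<close>

lemma joint_density_mono:
  assumes "corr 0 y \<le> corr c y"
  shows "joint_density 0 y \<le> joint_density c y"
proof -
  have "joint_density c y = exp (\<Sum>t\<in>UNIV. (bpsk c $ t - 1) * y t / \<sigma>\<^sup>2) * joint_density 0 y"
  proof -
    have "normal_density (bpsk c $ t) \<sigma> (y t)
        = exp ((bpsk c $ t - 1) * y t / \<sigma>\<^sup>2) * normal_density 1 \<sigma> (y t)" for t
      by (rule normal_density_sign_flip) (simp add: bpsk_nth)
    then show ?thesis
      by (simp add: joint_density_def prod.distrib exp_sum)
  qed
  moreover have "(\<Sum>t\<in>UNIV. (bpsk c $ t - 1) * y t / \<sigma>\<^sup>2) = (corr c y - corr 0 y) / \<sigma>\<^sup>2"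
    unfolding sum_divide_distrib[symmetric] by (simp add: corr_def left_diff_distrib sum_subtractf)
  moreover have "joint_density 0 y \<ge> 0"
    by (simp add: joint_density_def prod_nonneg)
  ultimately show ?thesis
    using assms mult_right_mono[of 1 "exp ((corr c y - corr 0 y) / \<sigma>\<^sup>2)" "joint_density 0 y"]
    by simp
qed

text \<open>A sign leaves the law of the centred noise unchanged and turns the mean 1 into
  \<open>bpsk c $ t\<close>; the coordinates stay independent, so the law is a product.\<close>

lemma distr_flip_received:
  "distr M (PiM UNIV (\<lambda>_. borel)) (\<lambda>\<omega>. flip c (received \<omega>))
    = density (PiM UNIV (\<lambda>_. lborel)) (joint_density c)"
proof -
  let ?f = "\<lambda>t. normal_density (bpsk c $ t) \<sigma>"
  interpret L: product_sigma_finite "\<lambda>_ :: 'n. lborel :: real measure"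
    by (intro product_sigma_finite.intro sigma_finite_lborel)
  have X: "distributed M lborel (\<lambda>\<omega>. flip c (received \<omega>) t) (?f t)" for t
  proof -
    have "distributed M lborel (\<lambda>\<omega>. bpsk c $ t + bpsk c $ t * Z t \<omega>)
        (normal_density (bpsk c $ t + bpsk c $ t * 0) (\<bar>bpsk c $ t\<bar> * \<sigma>))"
      by (intro normal_density_affine normal sigma_pos) (simp add: bpsk_nth)
    moreover have "\<bar>bpsk c $ t\<bar> = 1" by (simp add: bpsk_nth)
    ultimately show ?thesis by (simp add: flip_def received_def distrib_left)
  qed
  have ind: "indep_vars (\<lambda>_. borel) (\<lambda>t \<omega>. flip c (received \<omega>) t) UNIV"
    unfolding flip_def received_def
    by (rule indep_vars_compose2[OF indep]) auto
  have "distr M (PiM UNIV (\<lambda>_. borel)) (\<lambda>\<omega>. flip c (received \<omega>))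
      = PiM UNIV (\<lambda>t. distr M borel (\<lambda>\<omega>. flip c (received \<omega>) t))"
    using ind by (subst (asm) indep_vars_iff_distr_eq_PiM) (auto simp: restrict_def)
  also have "\<dots> = PiM UNIV (\<lambda>t. density lborel (?f t))"
  proof (intro PiM_cong refl)
    fix t
    have "distr M borel (\<lambda>\<omega>. flip c (received \<omega>) t) = distr M lborel (\<lambda>\<omega>. flip c (received \<omega>) t)"
      by (rule distr_cong) auto
    then show "distr M borel (\<lambda>\<omega>. flip c (received \<omega>) t) = density lborel (?f t)"
      using distributed_distr_eq_density[OF X] by simp
  qed
  also have "\<dots> = density (PiM UNIV (\<lambda>_. lborel)) (\<lambda>y. \<Prod>t\<in>UNIV. ennreal (?f t (y t)))"
  proof (rule L.PiM_density)
    show "sigma_finite_measure (density lborel (?f t))" for t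
      using prob_space_normal_density[OF sigma_pos]
      by (intro prob_space_imp_sigma_finite)
  qed auto
  also have "\<dots> = density (PiM UNIV (\<lambda>_. lborel)) (joint_density c)"
    by (simp add: joint_density_def prod_ennreal)
  finally show ?thesis .
qed

text \<open>Change of measure: on \<open>A\<close> the likelihood of \<open>c\<close> is at least
  that of \<open>0\<close>, and integration over \<open>A\<close> preserves this.\<close>

lemma prob_received_le_flip:
  assumes A [measurable]: "A \<in> sets (PiM UNIV (\<lambda>_. borel))"
    and le: "\<And>y. y \<in> A \<Longrightarrow> corr 0 y \<le> corr c y"
  shows "prob {\<omega> \<in> space M. received \<omega> \<in> A} \<le> prob {\<omega> \<in> space M. flip c (received \<omega>) \<in> A}"
proof -
  have sets_eq: "sets (PiM UNIV (\<lambda>_ :: 'n. lborel :: real measure)) = sets (PiM UNIV (\<lambda>_. borel))"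
    by (intro sets_PiM_cong) auto
  have jm: "joint_density c \<in> borel_measurable (PiM UNIV (\<lambda>_. lborel))" for c
    unfolding joint_density_def by measurable
  have eq: "emeasure M {\<omega> \<in> space M. flip c (received \<omega>) \<in> A}
      = (\<integral>\<^sup>+y. ennreal (joint_density c y) * indicator A y \<partial>PiM UNIV (\<lambda>_. lborel))" for c
  proof -
    have "emeasure M {\<omega> \<in> space M. flip c (received \<omega>) \<in> A}
        = emeasure (distr M (PiM UNIV (\<lambda>_. borel)) (\<lambda>\<omega>. flip c (received \<omega>))) A"
      by (subst emeasure_distr) (auto simp: vimage_def Int_def conj_commute)
    then show ?thesis
      unfolding distr_flip_received using A jm sets_eq by (simp add: emeasure_density)
  qed
  have "flip 0 y = y" for y :: "'n \<Rightarrow> real" by (simp add: flip_def)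
  then have "emeasure M {\<omega> \<in> space M. received \<omega> \<in> A}
      = (\<integral>\<^sup>+y. ennreal (joint_density 0 y) * indicator A y \<partial>PiM UNIV (\<lambda>_. lborel))"
    using eq[of 0] by simp
  also have "\<dots> \<le> (\<integral>\<^sup>+y. ennreal (joint_density c y) * indicator A y \<partial>PiM UNIV (\<lambda>_. lborel))"
    using joint_density_mono le
    by (intro nn_integral_mono) (auto simp: indicator_def intro!: ennreal_leI)
  also have "\<dots> = emeasure M {\<omega> \<in> space M. flip c (received \<omega>) \<in> A}"
    by (rule eq[symmetric])
  finally show ?thesis by (simp add: emeasure_eq_measure)
qed

section \<open>Pairwise errors, ties and hard-decision errors\<close>

text \<open>Variances of independent normals add up over the support, which has to be nonempty
  because an empty sum has no density.\<close>

lemma support_sum_normal: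
  assumes "c \<noteq> 0"
  shows "distributed M lborel (\<lambda>\<omega>. \<Sum>t | c $ t \<noteq> 0. Z t \<omega>)
    (normal_density 0 (sqrt (hamming_weight c) * \<sigma>))"
proof -
  have "distributed M lborel (\<lambda>\<omega>. \<Sum>t\<in>{t. c $ t \<noteq> 0}. Z t \<omega>)
      (normal_density (\<Sum>t\<in>{t. c $ t \<noteq> 0}. 0) (sqrt (\<Sum>t\<in>{t. c $ t \<noteq> 0}. \<sigma>\<^sup>2)))"
  proof (rule sum_indep_normal)
    show "{t. c $ t \<noteq> 0} \<noteq> {}" using assms by (auto simp: vec_eq_iff)
    show "indep_vars (\<lambda>_. borel) Z {t. c $ t \<noteq> 0}"
      by (rule indep_vars_subset[OF indep]) auto
  qed (use normal sigma_pos in auto)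
  then show ?thesis
    using sigma_pos by (simp add: hamming_weight_def real_sqrt_mult)
qed

lemma corr_received_diff:
  "corr 0 (received \<omega>) - corr c (received \<omega>)
    = 2 * (hamming_weight c + (\<Sum>t | c $ t \<noteq> 0. Z t \<omega>))"
  unfolding corr_zero_diff by (simp add: received_def sum.distrib hamming_weight_def)

text \<open>With \<open>d\<close> the weight of \<open>c\<close>, the error means that the noise
  summed over the support, of standard deviation \<open>sqrt d * \<sigma>\<close>, is at most
  \<open>- d\<close>.\<close>

lemma pairwise_error:
  assumes "c \<noteq> 0"
  shows "prob {\<omega> \<in> space M. corr 0 (received \<omega>) \<le> corr c (received \<omega>)}
    = Q_fun (sqrt (hamming_weight c) / \<sigma>)"
proof -
  have "{\<omega> \<in> space M. corr 0 (received \<omega>) \<le> corr c (received \<omega>)}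
      = {\<omega> \<in> space M. (\<Sum>t | c $ t \<noteq> 0. Z t \<omega>) \<le> - real (hamming_weight c)}"
    using corr_received_diff[of _ c] by (smt (verit) Collect_cong)
  also have "prob \<dots> = Q_fun (real (hamming_weight c) / (sqrt (hamming_weight c) * \<sigma>))"
    using support_sum_normal[OF assms] hamming_weight_pos[OF assms] sigma_pos
    by (intro prob_normal_le_neg) auto
  also have "real (hamming_weight c) / (sqrt (hamming_weight c) * \<sigma>) = sqrt (hamming_weight c) / \<sigma>"
    by (metis divide_divide_eq_left of_nat_0_le_iff real_div_sqrt)
  finally show ?thesis .
qed

text \<open>A tie prescribes the value of a normal variable, whose law has no atoms.\<close>

lemma prob_tie:
  assumes "c \<noteq> 0"
  shows "prob {\<omega> \<in> space M. corr 0 (received \<omega>) = corr c (received \<omega>)} = 0"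
proof -
  have "{\<omega> \<in> space M. corr 0 (received \<omega>) = corr c (received \<omega>)}
      = {\<omega> \<in> space M. (\<Sum>t | c $ t \<noteq> 0. Z t \<omega>) = - real (hamming_weight c)}"
    using corr_received_diff[of _ c] by (smt (verit) Collect_cong)
  then show ?thesis
    using prob_normal_singleton[OF support_sum_normal[OF assms]] by simp
qed

text \<open>Position \<open>t\<close> is counted iff \<open>1 + Z t \<omega> \<le> 0\<close>; these
  events are independent, each of probability \<open>Q_fun (1 / \<sigma>)\<close>.\<close>

lemma prob_disagree_gt:
  "prob {\<omega> \<in> space M. ds < disagree 0 (received \<omega>)}
    = binom_sum (Q_fun (1 / \<sigma>)) CARD('n) (ds + 1) CARD('n)"
proof -
  have "prob (Z t -` {..- 1} \<inter> space M) = Q_fun (1 / \<sigma>)" for t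
    using prob_normal_le_neg[OF normal sigma_pos, of t 1]
    by (simp add: vimage_def Int_def conj_commute)
  then have "prob {\<omega> \<in> space M. ds + 1 \<le> card {t \<in> UNIV. Z t \<omega> \<in> {..- 1}}}
      = binom_sum (Q_fun (1 / \<sigma>)) CARD('n) (ds + 1) CARD('n)"
    by (intro prob_card_ge_binomial[OF indep]) auto
  moreover have "disagree 0 (received \<omega>) = card {t \<in> UNIV. Z t \<omega> \<in> {..- 1}}" for \<omega>
    unfolding disagree_def received_def by (intro arg_cong[of _ _ card]) auto
  ultimately show ?thesis by (simp add: Suc_le_eq)
qed

section \<open>Comparison of the two decoders\<close>

text \<open>
  On \<open>nearest C c\<close> the word \<open>c\<close> has the largest likelihood, so replacing the law of the
  received vector by its law under \<open>c\<close> can only increase the probability; by symmetry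
  the replaced probabilities are those of disjoint events inside \<open>nearest C 0\<close>.
\<close>

lemma list_correct_le_nearest:
  assumes C: "vec.subspace C"
  shows "prob {\<omega> \<in> space M. received \<omega> \<in> list_correct C ds}
    \<le> prob {\<omega> \<in> space M. received \<omega> \<in> nearest C 0}"
proof -
  have "0 \<in> C" using C by (rule vec.subspace_0)
  define S where "S c = list_correct C ds \<inter> nearest C c" for c
  have S_meas [measurable]: "S c \<in> sets (PiM UNIV (\<lambda>_. borel))" for c
    unfolding S_def by measurable
  have cover: "list_correct C ds \<subseteq> (\<Union>c\<in>C. S c)"
  proof
    fix y assume y: "y \<in> list_correct C ds"
    have "Max ((\<lambda>c. corr c y) ` C) \<in> (\<lambda>c. corr c y) ` C"
      using finite_bit_vec \<open>0 \<in> C\<close> by (intro Max_in) auto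
    then obtain c where c: "c \<in> C" "corr c y = Max ((\<lambda>c. corr c y) ` C)"
      by auto
    then have "y \<in> nearest C c"
      unfolding nearest_def using c(2) by (auto intro!: Max_ge finite_imageI finite_bit_vec)
    then show "y \<in> (\<Union>c\<in>C. S c)"
      using y c(1) by (auto simp: S_def)
  qed
  have "prob {\<omega> \<in> space M. received \<omega> \<in> list_correct C ds}
      \<le> prob (\<Union>c\<in>C. {\<omega> \<in> space M. received \<omega> \<in> S c})"
    using cover by (intro finite_measure_mono sets.finite_UN finite_bit_vec) (auto; measurable)+
  \<comment> \<open>The pieces may overlap in ties, so only subadditivity is available here.\<close>
  also have "\<dots> \<le> (\<Sum>c\<in>C. prob {\<omega> \<in> space M. received \<omega> \<in> S c})"
    by (intro finite_measure_subadditive_finite finite_bit_vec) auto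
  also have "\<dots> \<le> (\<Sum>c\<in>C. prob {\<omega> \<in> space M. flip c (received \<omega>) \<in> S c})"
    using \<open>0 \<in> C\<close> by (intro sum_mono prob_received_le_flip S_meas) (auto simp: S_def nearest_def)
  \<comment> \<open>At most one flip of a given vector by a codeword lies in
    \<open>list_correct C ds\<close>, so the flipped events are disjoint and the sum is again a
    probability.\<close>
  also have "\<dots> = prob (\<Union>c\<in>C. {\<omega> \<in> space M. flip c (received \<omega>) \<in> S c})"
    using flip_list_correct_unique[OF C]
    by (intro finite_measure_finite_Union[symmetric] finite_bit_vec)
       (auto simp: disjoint_family_on_def S_def)
  also have "\<dots> \<le> prob {\<omega> \<in> space M. received \<omega> \<in> nearest C 0}"
    using flip_in_nearest[OF C] by (intro finite_measure_mono) (auto simp: S_def)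
  finally show ?thesis .
qed

text \<open>Union bound: failure requires more than \<open>ds\<close> wrong hard decisions or a
  listed rival at least as near as \<open>0\<close>.\<close>

lemma prob_not_list_correct:
  "prob {\<omega> \<in> space M. received \<omega> \<notin> list_correct C ds}
    \<le> (\<Sum>d = min_distance C..2 * ds. real (num_codewords C d) * Q_fun (sqrt (real d) / \<sigma>))
      + binom_sum (Q_fun (1 / \<sigma>)) CARD('n) (ds + 1) CARD('n)"
proof -
  define low where "low = {c \<in> C - {0}. hamming_weight c \<le> 2 * ds}"
  let ?e = "\<lambda>c. {\<omega> \<in> space M. corr 0 (received \<omega>) \<le> corr c (received \<omega>)}"
  let ?h = "{\<omega> \<in> space M. ds < disagree 0 (received \<omega>)}"
  have fin: "finite low" by (rule finite_bit_vec)
  have sub: "{\<omega> \<in> space M. received \<omega> \<notin> list_correct C ds} \<subseteq> (\<Union>c\<in>low. ?e c) \<union> ?h"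
  proof
    fix \<omega> assume "\<omega> \<in> {\<omega> \<in> space M. received \<omega> \<notin> list_correct C ds}"
    then have \<omega>: "\<omega> \<in> space M" "received \<omega> \<notin> list_correct C ds" by auto
    show "\<omega> \<in> (\<Union>c\<in>low. ?e c) \<union> ?h"
    proof (cases "ds < disagree 0 (received \<omega>)")
      case False
      then obtain c where c: "c \<in> C - {0}" "disagree c (received \<omega>) \<le> ds"
          "corr 0 (received \<omega>) \<le> corr c (received \<omega>)"
        using \<omega> by (force simp: list_correct_def)
      \<comment> \<open>Both \<open>0\<close> and \<open>c\<close> are within \<open>ds\<close> of
        the hard decision, whence the weight bound \<open>2 * ds\<close>.\<close>
      then have "c \<in> low"
        using False hamming_weight_le_disagree[of c "received \<omega>"] by (simp add: low_def)
      then show ?thesis using c \<omega> by blast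
    qed (use \<omega> in simp)
  qed
  have meas: "?e c \<in> sets M" "?h \<in> sets M" for c by measurable
  have "prob {\<omega> \<in> space M. received \<omega> \<notin> list_correct C ds} \<le> prob ((\<Union>c\<in>low. ?e c) \<union> ?h)"
    using meas fin by (intro finite_measure_mono[OF sub] sets.Un sets.finite_UN) auto
  also have "\<dots> \<le> prob (\<Union>c\<in>low. ?e c) + prob ?h"
    using meas fin by (intro measure_Un_le sets.finite_UN) auto
  also have "prob (\<Union>c\<in>low. ?e c) \<le> (\<Sum>c\<in>low. prob (?e c))"
    using meas fin by (intro finite_measure_subadditive_finite) auto
  also have "(\<Sum>c\<in>low. prob (?e c)) = (\<Sum>c\<in>low. Q_fun (sqrt (hamming_weight c) / \<sigma>))"
    by (intro sum.cong) (auto simp: low_def pairwise_error)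
  \<comment> \<open>Group by weight. If \<open>C\<close> has no nonzero codeword,
    \<open>min_distance C\<close> is unspecified, but then \<open>low\<close> is empty.\<close>
  also have "\<dots> = (\<Sum>d = min_distance C..2 * ds. \<Sum>c | c \<in> low \<and> hamming_weight c = d.
      Q_fun (sqrt (hamming_weight c) / \<sigma>))"
    using fin
    by (intro sum.group[symmetric]) (auto simp: low_def min_distance_def finite_bit_vec intro!: Min_le)
  also have "\<dots> \<le> (\<Sum>d = min_distance C..2 * ds. real (num_codewords C d) * Q_fun (sqrt (real d) / \<sigma>))"
  proof (rule sum_mono)
    fix d
    have "(\<Sum>c | c \<in> low \<and> hamming_weight c = d. Q_fun (sqrt (hamming_weight c) / \<sigma>))
        = real (card {c \<in> low. hamming_weight c = d}) * Q_fun (sqrt (real d) / \<sigma>)"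
      by simp
    \<comment> \<open>Inclusion of the two sets of codewords gives this for every \<open>d\<close>,
      even where the zero word is counted on the right.\<close>
    also have "\<dots> \<le> real (num_codewords C d) * Q_fun (sqrt (real d) / \<sigma>)"
      unfolding num_codewords_def
      by (intro mult_right_mono of_nat_mono card_mono finite_bit_vec Q_fun_nonneg) (auto simp: low_def)
    finally show "(\<Sum>c | c \<in> low \<and> hamming_weight c = d. Q_fun (sqrt (hamming_weight c) / \<sigma>))
        \<le> real (num_codewords C d) * Q_fun (sqrt (real d) / \<sigma>)" .
  qed
  finally show ?thesis by (simp add: prob_disagree_gt)
qed

section \<open>Error probability of maximum-likelihood decoding\<close>

text \<open>A wrong output is at least as near as \<open>0\<close>, so either \<open>0\<close> is
  not nearest or the output ties with it. Comparison with the list decoder bounds the first case;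
  the second has probability zero.\<close>

lemma ml_error_bound:
  assumes C: "vec.subspace C" and ml: "ml_decoder C dec"
    and E: "{\<omega> \<in> space M. dec (awgn_output 0 Z \<omega>) \<noteq> 0} \<in> events" (is "?E \<in> _")
  shows "prob ?E
    \<le> (\<Sum>d = min_distance C..2 * ds. real (num_codewords C d) * Q_fun (sqrt (real d) / \<sigma>))
      + binom_sum (Q_fun (1 / \<sigma>)) CARD('n) (ds + 1) CARD('n)"
proof -
  let ?N = "{\<omega> \<in> space M. received \<omega> \<notin> nearest C 0}"
  let ?T = "\<lambda>c. {\<omega> \<in> space M. corr 0 (received \<omega>) = corr c (received \<omega>)}"
  have "0 \<in> C" using C by (rule vec.subspace_0)
  have out: "($) (awgn_output 0 Z \<omega>) = received \<omega>" for \<omega>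
    by (simp add: awgn_output_def received_def fun_eq_iff)
  have sub: "?E \<subseteq> ?N \<union> (\<Union>c\<in>C - {0}. ?T c)"
  proof
    fix \<omega> assume \<omega>: "\<omega> \<in> ?E"
    define c where "c = dec (awgn_output 0 Z \<omega>)"
    have "is_arg_min (\<lambda>c. dist (awgn_output 0 Z \<omega>) (bpsk c)) (\<lambda>c. c \<in> C) c"
      using ml by (simp add: ml_decoder_def c_def)
    then have "c \<in> C" "dist (awgn_output 0 Z \<omega>) (bpsk c) \<le> dist (awgn_output 0 Z \<omega>) (bpsk 0)"
      using \<open>0 \<in> C\<close> by (auto simp: is_arg_min_linorder)
    then have "corr 0 (received \<omega>) \<le> corr c (received \<omega>)"
      by (simp add: dist_bpsk_le_iff out)
    then show "\<omega> \<in> ?N \<union> (\<Union>c\<in>C - {0}. ?T c)"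
      using \<omega> \<open>c \<in> C\<close> by (force simp: c_def[symmetric] nearest_def)
  qed
  have meas [measurable]: "?N \<in> events" "?T c \<in> events" for c by measurable
  have "prob ?E \<le> prob (?N \<union> (\<Union>c\<in>C - {0}. ?T c))"
    using meas by (intro finite_measure_mono[OF sub] sets.Un sets.finite_UN finite_bit_vec) auto
  also have "\<dots> \<le> prob ?N + prob (\<Union>c\<in>C - {0}. ?T c)"
    using meas by (intro measure_Un_le sets.finite_UN finite_bit_vec) auto
  also have "prob (\<Union>c\<in>C - {0}. ?T c) \<le> (\<Sum>c\<in>C - {0}. prob (?T c))"
    using meas finite_bit_vec by (intro finite_measure_subadditive_finite) auto
  also have "(\<Sum>c\<in>C - {0}. prob (?T c)) = 0"
    by (intro sum.neutral) (auto simp: prob_tie)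
  \<comment> \<open>The comparison of the probabilities of correct decoding is reversed on
    complements.\<close>
  also have "prob ?N + 0 \<le> prob {\<omega> \<in> space M. received \<omega> \<notin> list_correct C ds}"
    using list_correct_le_nearest[OF C, of ds]
    by (simp add: prob_neg)
  also note prob_not_list_correct
  finally show ?thesis by simp
qed

end

theorem theorem1:
  fixes C :: "(bit ^ 'n) set"
    and k :: nat
    and \<sigma> :: real
    and M :: "'w measure"
    and Z :: "'n \<Rightarrow> 'w \<Rightarrow> real"
    and dec :: "real ^ 'n \<Rightarrow> bit ^ 'n"
    and E :: "'w set"
  assumes "vec.subspace C"
    and "vec.dim C = k" and "k \<ge> 1"
    and "\<sigma> > 0"
    and "prob_space M"
    and "prob_space.indep_vars M (\<lambda>_. borel) Z UNIV"
    and "\<And>t. distributed M lborel (Z t) (normal_density 0 \<sigma>)"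
    and "ml_decoder C dec"
    and "E = {\<omega> \<in> space M. dec (awgn_output 0 Z \<omega>) \<noteq> 0}"
    and "E \<in> sets M"
  shows "measure M E \<le>
    (MIN ds \<in> {0..CARD('n)}.
      (\<Sum>d = min_distance C..2 * ds. real (num_codewords C d) * Q_fun (sqrt (real d) / \<sigma>))
      + binom_sum (Q_fun (1 / \<sigma>)) CARD('n) (ds + 1) CARD('n))"
proof -
  interpret awgn M Z \<sigma>
    using assms(4-7) by (auto simp: awgn_def awgn_axioms_def)
  show ?thesis
    using ml_error_bound[OF assms(1,8)] assms(9,10) by (intro Min.boundedI) auto
qed

end
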